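(* (Theorem for $Z$-homomorphisms.) Let $\lambda\mapsto\overline\lambda$ be a $Z$-homomorphism from $[M;\mathcal L]$ in $[M;\mathcal L']$. Suppose $[\Lambda]=[F_1;\dots;F_l]$ is a proof in $[M;\mathcal L]$ such that no variable of $Z$ occurs in $F_1,\dots,F_l$. Then $F_1,\dots,F_l\in\Phi^Z_{M;\mathcal L}$ and $[\overline{F_1};\dots;\overline{F_l}]$ is a proof in $[M;\mathcal L']$.
   Context: Formulas are in Polish notation. Symbols (pairwise disjoint): a set $A_M$ of constant/operation symbols, a set $P_M$ of predicate symbols, a countably infinite set $X$ of variables, and $\sim,(,),\,,\,,\to,\neg,\leftrightarrow,\&,\vee,\forall,\exists$. Lists: $a\in A_M$, $x\in X$, $f(\lambda)$, concatenations; $\lambda\frac{\mu}{x}$ replaces every $x$ in $\lambda$ by $\mu$. Prime formulas $\sim\lambda,\mu$ and $p\,\lambda_1,\dots,\lambda_n$; formulas built with $\neg$, $J\in\{\to,\leftrightarrow,\&,\vee\}$, $\forall x$, $\exists x$. Argument lists: maximal lists not immediately following a quantifier. $\mathrm{SbF}(F;\mu;x)=F\frac{\mu}{x}$ replaces free occurrences of $x$ by $\mu$; $\mathrm{CF}(F;\mu;x)$: true for prime $F$, passes through connectives, $\mathrm{CF}(QyF;\mu;x)$ iff $x\notin\mathrm{free}(F)\setminus\{y\}$ or ($y\notin\mathrm{var}(\mu)$ and $\mathrm{CF}(F;\mu;x)$). A recursive system $S=[A_S;P_S;B_S]$: finite $A_S\subseteq A_M$, $P_S\subseteq P_M$, finite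 list $B_S$ of R-formulas ($\to F_1\dots\to F_rG$, prime $F_j,G$; $G$ the R-conclusion). Mathematical system $M=[S;A_M;P_M;B_M]$, $B_M\supseteq B_S$. Axioms: tautology instances; equality axioms $\sim x,x$, $\to\mathrm{SbF}(\sim\lambda,\mu;x;y)\to\sim x,y\ \sim\lambda,\mu$, $\to\sim x_1,y_1\dots\to\sim x_n,y_n\to p\,x_1..x_n\ p\,y_1..y_n$; quantifier axioms $\to\forall xF\,F$, $\to\forall x\to FG\to F\forall xG$ ($x\notin\mathrm{free}(F)$), $\leftrightarrow\neg\forall x\neg F\ \exists xF$; $B_M$. Rules: axiom, modus ponens, substitution $\mathrm{SbF}(F;\lambda;x)$ under $\mathrm{CF}(F;\lambda;x)$, generalization, Induction (for $p\in P_S$, $i\ge0$, distinct $x_1..x_i$ and $G$ such that the $x_j$ and the variables of $G$ do not occur in $B_S$: if for each $F\in B_S$ with $i$-ary R-conclusion of predicate $p$ the formula obtained by replacing each $i$-ary $p\,\lambda_1..\lambda_i$ by $G\frac{\lambda_1}{x_1}\cdots\frac{\lambda_i}{x_i}$ is a step, append $\to p\,x_1..x_i\,G$). Restricted argument lists: $\mathcal L\supseteq X$ closed under $\lambda\frac{\mu}{x}$ for $\lambda,\mu\in\mathcal L$, containing argument lists of $B_M$; $[M;\mathcal L]$ restricts all formulas in proofs (and in the rules) to argument lists in $\mathcal L$ and substituted lists to $\mathcal L$. $Z$-homomorphism: let $[M;\mathcal L]$, $[M;\mathcal L']$ be systems with restricted argument lists and $Z\subseteq X$. A map $\lambda\mapsto\overline\lambda$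 from $\mathcal L$ to $\mathcal L'$ with (ZH1) $\overline y=y$ for $y\in X$, (ZH2) $\overline{\lambda\frac{\mu}{x}}=\overline\lambda\frac{\overline\mu}{x}$ for $x\in X\setminus Z$, (ZH3) $\mathrm{var}(\overline\mu)\subseteq\mathrm{var}(\mu)\cup Z$ is extended to the set $\Phi^Z_{M;\mathcal L}$ of formulas of $[M;\mathcal L]$ without subformulas $Q\,z\,F'$ ($z\in Z$, $Q\in\{\forall,\exists\}$) by replacing every argument list $\lambda$ by $\overline\lambda$; it is a $Z$-homomorphism if moreover (ZH4) $\overline F=F$ for all $F\in B_M\cap\Phi^Z_{M;\mathcal L}$ and (ZH5) no variable of $Z$ occurs in $B_S$. *)

theory Defs
  imports Main
begin

text \<open>The variables are the natural numbers (\<open>X\<close> is countably infinite). Lists are kept as words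
  of symbols, so that \<open>\<lambda> \<mu>/x\<close> is literally the replacement of every occurrence of \<open>x\<close>. Formulas
  in Polish notation are uniquely readable and are represented by their syntax trees.\<close>

type_synonym var = nat

datatype 'a sym = Op 'a | Var var | LPar | RPar

type_synonym 'a word = "'a sym list"

inductive_set lists_of :: "'a set \<Rightarrow> 'a word set" for A :: "'a set" where
  const: "a \<in> A \<Longrightarrow> [Op a] \<in> lists_of A"
| var: "[Var x] \<in> lists_of A"
| app: "f \<in> A \<Longrightarrow> l \<in> lists_of A \<Longrightarrow> [Op f, LPar] @ l @ [RPar] \<in> lists_of A"
| conc: "l \<in> lists_of A \<Longrightarrow> m \<in> lists_of A \<Longrightarrow> l @ m \<in> lists_of A"

definition var_list :: "'a word \<Rightarrow> var set" where
  "var_list l = {x. Var x \<in> set l}"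

definition sb_list :: "'a word \<Rightarrow> 'a word \<Rightarrow> var \<Rightarrow> 'a word" where
  "sb_list l m x = concat (map (\<lambda>s. if s = Var x then m else [s]) l)"

datatype conn = Imp | Iff | And | Or
datatype quant = All | Ex

datatype ('a, 'p) fm =
    Eq "'a word" "'a word"
  | Pred 'p "'a word list"
  | Neg "('a, 'p) fm"
  | Bin conn "('a, 'p) fm" "('a, 'p) fm"
  | Quant quant var "('a, 'p) fm"

primrec is_prime :: "('a, 'p) fm \<Rightarrow> bool" where
  "is_prime (Eq l m) = True"
| "is_prime (Pred p ls) = True"
| "is_prime (Neg F) = False"
| "is_prime (Bin J F G) = False"
| "is_prime (Quant Q x F) = False"

primrec arg_lists :: "('a, 'p) fm \<Rightarrow> 'a word set" where
  "arg_lists (Eq l m) = {l, m}"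
| "arg_lists (Pred p ls) = set ls"
| "arg_lists (Neg F) = arg_lists F"
| "arg_lists (Bin J F G) = arg_lists F \<union> arg_lists G"
| "arg_lists (Quant Q x F) = arg_lists F"

primrec preds :: "('a, 'p) fm \<Rightarrow> 'p set" where
  "preds (Eq l m) = {}"
| "preds (Pred p ls) = {p}"
| "preds (Neg F) = preds F"
| "preds (Bin J F G) = preds F \<union> preds G"
| "preds (Quant Q x F) = preds F"

text \<open>All variables of a formula, including those that occur only immediately after a quantifier.\<close>

primrec vars :: "('a, 'p) fm \<Rightarrow> var set" where
  "vars (Eq l m) = var_list l \<union> var_list m"
| "vars (Pred p ls) = (\<Union>l\<in>set ls. var_list l)"
| "vars (Neg F) = vars F"
| "vars (Bin J F G) = vars F \<union> vars G"
| "vars (Quant Q x F) = insert x (vars F)"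

primrec free :: "('a, 'p) fm \<Rightarrow> var set" where
  "free (Eq l m) = var_list l \<union> var_list m"
| "free (Pred p ls) = (\<Union>l\<in>set ls. var_list l)"
| "free (Neg F) = free F"
| "free (Bin J F G) = free F \<union> free G"
| "free (Quant Q x F) = free F - {x}"

primrec subformulas :: "('a, 'p) fm \<Rightarrow> ('a, 'p) fm set" where
  "subformulas (Eq l m) = {Eq l m}"
| "subformulas (Pred p ls) = {Pred p ls}"
| "subformulas (Neg F) = insert (Neg F) (subformulas F)"
| "subformulas (Bin J F G) = insert (Bin J F G) (subformulas F \<union> subformulas G)"
| "subformulas (Quant Q x F) = insert (Quant Q x F) (subformulas F)"

primrec SbF :: "('a, 'p) fm \<Rightarrow> 'a word \<Rightarrow> var \<Rightarrow> ('a, 'p) fm" where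
  "SbF (Eq l m) n x = Eq (sb_list l n x) (sb_list m n x)"
| "SbF (Pred p ls) n x = Pred p (map (\<lambda>l. sb_list l n x) ls)"
| "SbF (Neg F) n x = Neg (SbF F n x)"
| "SbF (Bin J F G) n x = Bin J (SbF F n x) (SbF G n x)"
| "SbF (Quant Q y F) n x = (if y = x then Quant Q y F else Quant Q y (SbF F n x))"

primrec CF :: "('a, 'p) fm \<Rightarrow> 'a word \<Rightarrow> var \<Rightarrow> bool" where
  "CF (Eq l m) n x \<longleftrightarrow> True"
| "CF (Pred p ls) n x \<longleftrightarrow> True"
| "CF (Neg F) n x \<longleftrightarrow> CF F n x"
| "CF (Bin J F G) n x \<longleftrightarrow> CF F n x \<and> CF G n x"
| "CF (Quant Q y F) n x \<longleftrightarrow> x \<notin> free F - {y} \<or> (y \<notin> var_list n \<and> CF F n x)"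

definition imps :: "('a, 'p) fm list \<Rightarrow> ('a, 'p) fm \<Rightarrow> ('a, 'p) fm" where
  "imps Fs G = foldr (Bin Imp) Fs G"

definition R_formula :: "('a, 'p) fm \<Rightarrow> bool" where
  "R_formula F \<longleftrightarrow> (\<exists>Fs G. F = imps Fs G \<and> (\<forall>H\<in>set Fs. is_prime H) \<and> is_prime G)"

fun R_conclusion :: "('a, 'p) fm \<Rightarrow> ('a, 'p) fm" where
  "R_conclusion (Bin Imp F G) = R_conclusion G"
| "R_conclusion F = F"

record ('a, 'p) rec_sys =
  A_S :: "'a set"
  P_S :: "'p set"
  B_S :: "('a, 'p) fm list"

record ('a, 'p) math_sys =
  S_M :: "('a, 'p) rec_sys"
  A_M :: "'a set"
  P_M :: "'p set"
  B_M :: "('a, 'p) fm set"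

definition recursive_system :: "('a, 'p) rec_sys \<Rightarrow> bool" where
  "recursive_system S \<longleftrightarrow> finite (A_S S) \<and> finite (P_S S) \<and>
     (\<forall>F\<in>set (B_S S). R_formula F \<and> arg_lists F \<subseteq> lists_of (A_S S) \<and> preds F \<subseteq> P_S S)"

definition formulas :: "('a, 'p) math_sys \<Rightarrow> ('a, 'p) fm set" where
  "formulas M = {F. arg_lists F \<subseteq> lists_of (A_M M) \<and> preds F \<subseteq> P_M M}"

definition mathematical_system :: "('a, 'p) math_sys \<Rightarrow> bool" where
  "mathematical_system M \<longleftrightarrow> recursive_system (S_M M) \<and>
     A_S (S_M M) \<subseteq> A_M M \<and> P_S (S_M M) \<subseteq> P_M M \<and>
     set (B_S (S_M M)) \<subseteq> B_M M \<and> B_M M \<subseteq> formulas M"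

definition restricted_arg_lists :: "('a, 'p) math_sys \<Rightarrow> 'a word set \<Rightarrow> bool" where
  "restricted_arg_lists M L \<longleftrightarrow>
     L \<subseteq> lists_of (A_M M) \<and>
     (\<forall>x. [Var x] \<in> L) \<and>
     (\<forall>l\<in>L. \<forall>m\<in>L. \<forall>x. sb_list l m x \<in> L) \<and>
     (\<forall>F\<in>B_M M. arg_lists F \<subseteq> L)"

definition formulas_restr :: "('a, 'p) math_sys \<Rightarrow> 'a word set \<Rightarrow> ('a, 'p) fm set" where
  "formulas_restr M L = {F \<in> formulas M. arg_lists F \<subseteq> L}"

text \<open>Propositional functions, used to express instances of tautologies.\<close>

datatype pfm = PVar nat | PNeg pfm | PBin conn pfm pfm

primrec conn_sem :: "conn \<Rightarrow> bool \<Rightarrow> bool \<Rightarrow> bool" where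
  "conn_sem Imp a b = (a \<longrightarrow> b)"
| "conn_sem Iff a b = (a \<longleftrightarrow> b)"
| "conn_sem And a b = (a \<and> b)"
| "conn_sem Or a b = (a \<or> b)"

primrec pfm_sem :: "(nat \<Rightarrow> bool) \<Rightarrow> pfm \<Rightarrow> bool" where
  "pfm_sem v (PVar i) = v i"
| "pfm_sem v (PNeg f) = (\<not> pfm_sem v f)"
| "pfm_sem v (PBin J f g) = conn_sem J (pfm_sem v f) (pfm_sem v g)"

definition tautology :: "pfm \<Rightarrow> bool" where
  "tautology f \<longleftrightarrow> (\<forall>v. pfm_sem v f)"

primrec pfm_inst :: "(nat \<Rightarrow> ('a, 'p) fm) \<Rightarrow> pfm \<Rightarrow> ('a, 'p) fm" where
  "pfm_inst s (PVar i) = s i"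
| "pfm_inst s (PNeg f) = Neg (pfm_inst s f)"
| "pfm_inst s (PBin J f g) = Bin J (pfm_inst s f) (pfm_inst s g)"

abbreviation var_lists :: "var list \<Rightarrow> 'a word list" where
  "var_lists xs \<equiv> map (\<lambda>x. [Var x]) xs"

inductive_set axioms_restr :: "('a, 'p) math_sys \<Rightarrow> 'a word set \<Rightarrow> ('a, 'p) fm set"
  for M :: "('a, 'p) math_sys" and L :: "'a word set" where
  taut: "tautology f \<Longrightarrow> (\<And>i. s i \<in> formulas_restr M L) \<Longrightarrow> pfm_inst s f \<in> axioms_restr M L"
| eq_refl: "Eq [Var x] [Var x] \<in> axioms_restr M L"
| eq_list: "l \<in> L \<Longrightarrow> m \<in> L \<Longrightarrow>
    Bin Imp (SbF (Eq l m) [Var x] y) (Bin Imp (Eq [Var x] [Var y]) (Eq l m)) \<in> axioms_restr M L"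
| eq_pred: "p \<in> P_M M \<Longrightarrow> length xs = length ys \<Longrightarrow>
    imps (map2 (\<lambda>x y. Eq [Var x] [Var y]) xs ys)
      (Bin Imp (Pred p (var_lists xs)) (Pred p (var_lists ys))) \<in> axioms_restr M L"
| all_elim: "F \<in> formulas_restr M L \<Longrightarrow> Bin Imp (Quant All x F) F \<in> axioms_restr M L"
| all_imp: "F \<in> formulas_restr M L \<Longrightarrow> G \<in> formulas_restr M L \<Longrightarrow> x \<notin> free F \<Longrightarrow>
    Bin Imp (Quant All x (Bin Imp F G)) (Bin Imp F (Quant All x G)) \<in> axioms_restr M L"
| ex_def: "F \<in> formulas_restr M L \<Longrightarrow>
    Bin Iff (Neg (Quant All x (Neg F))) (Quant Ex x F) \<in> axioms_restr M L"
| basis: "F \<in> B_M M \<Longrightarrow> F \<in> axioms_restr M L"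

text \<open>\<open>replace_pred p xs G F\<close> replaces in \<open>F\<close> each subformula \<open>p \<lambda>\<^sub>1,\<dots>,\<lambda>\<^sub>i\<close> with \<open>i = length xs\<close>
  by \<open>G \<lambda>\<^sub>1/x\<^sub>1 \<dots> \<lambda>\<^sub>i/x\<^sub>i\<close>. The same predicate symbol may also occur with other arities; those
  occurrences are kept.\<close>

primrec replace_pred ::
  "'p \<Rightarrow> var list \<Rightarrow> ('a, 'p) fm \<Rightarrow> ('a, 'p) fm \<Rightarrow> ('a, 'p) fm" where
  "replace_pred p xs G (Eq l m) = Eq l m"
| "replace_pred p xs G (Pred q ls) =
     (if q = p \<and> length ls = length xs
      then fold (\<lambda>(x, l) H. SbF H l x) (zip xs ls) G
      else Pred q ls)"
| "replace_pred p xs G (Neg F) = Neg (replace_pred p xs G F)"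
| "replace_pred p xs G (Bin J F F') = Bin J (replace_pred p xs G F) (replace_pred p xs G F')"
| "replace_pred p xs G (Quant Q x F) = Quant Q x (replace_pred p xs G F)"

definition vars_B_S :: "('a, 'p) math_sys \<Rightarrow> var set" where
  "vars_B_S M = (\<Union>F\<in>set (B_S (S_M M)). vars F)"

inductive is_proof :: "('a, 'p) math_sys \<Rightarrow> 'a word set \<Rightarrow> ('a, 'p) fm list \<Rightarrow> bool"
  for M :: "('a, 'p) math_sys" and L :: "'a word set" where
  empty: "is_proof M L []"
| axiom: "is_proof M L \<Lambda> \<Longrightarrow> F \<in> axioms_restr M L \<Longrightarrow> is_proof M L (\<Lambda> @ [F])"
| modus_ponens: "is_proof M L \<Lambda> \<Longrightarrow> F \<in> set \<Lambda> \<Longrightarrow> Bin Imp F G \<in> set \<Lambda> \<Longrightarrow> is_proof M L (\<Lambda> @ [G])"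
| substitution: "is_proof M L \<Lambda> \<Longrightarrow> F \<in> set \<Lambda> \<Longrightarrow> l \<in> L \<Longrightarrow> CF F l x \<Longrightarrow>
    is_proof M L (\<Lambda> @ [SbF F l x])"
| generalization: "is_proof M L \<Lambda> \<Longrightarrow> F \<in> set \<Lambda> \<Longrightarrow> is_proof M L (\<Lambda> @ [Quant All x F])"
| induction: "is_proof M L \<Lambda> \<Longrightarrow> p \<in> P_S (S_M M) \<Longrightarrow> distinct xs \<Longrightarrow> G \<in> formulas_restr M L \<Longrightarrow>
    (set xs \<union> vars G) \<inter> vars_B_S M = {} \<Longrightarrow>
    (\<And>F ls. F \<in> set (B_S (S_M M)) \<Longrightarrow> R_conclusion F = Pred p ls \<Longrightarrow> length ls = length xs \<Longrightarrow>
       replace_pred p xs G F \<in> set \<Lambda>) \<Longrightarrow>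
    is_proof M L (\<Lambda> @ [Bin Imp (Pred p (var_lists xs)) G])"

definition Phi :: "('a, 'p) math_sys \<Rightarrow> 'a word set \<Rightarrow> var set \<Rightarrow> ('a, 'p) fm set" where
  "Phi M L Z = {F \<in> formulas_restr M L. \<not> (\<exists>Q z F'. z \<in> Z \<and> Quant Q z F' \<in> subformulas F)}"

primrec ext :: "('a word \<Rightarrow> 'a word) \<Rightarrow> ('a, 'p) fm \<Rightarrow> ('a, 'p) fm" where
  "ext h (Eq l m) = Eq (h l) (h m)"
| "ext h (Pred p ls) = Pred p (map h ls)"
| "ext h (Neg F) = Neg (ext h F)"
| "ext h (Bin J F G) = Bin J (ext h F) (ext h G)"
| "ext h (Quant Q x F) = Quant Q x (ext h F)"

definition Z_homomorphism ::
  "('a, 'p) math_sys \<Rightarrow> 'a word set \<Rightarrow> 'a word set \<Rightarrow> var set \<Rightarrow> ('a word \<Rightarrow> 'a word) \<Rightarrow> bool" where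
  "Z_homomorphism M L L' Z h \<longleftrightarrow>
     (\<forall>l\<in>L. h l \<in> L') \<and>
     (\<forall>y. h [Var y] = [Var y]) \<and>
     (\<forall>l\<in>L. \<forall>m\<in>L. \<forall>x. x \<notin> Z \<longrightarrow> h (sb_list l m x) = sb_list (h l) (h m) x) \<and>
     (\<forall>m\<in>L. var_list (h m) \<subseteq> var_list m \<union> Z) \<and>
     (\<forall>F\<in>B_M M \<inter> Phi M L Z. ext h F = F) \<and>
     Z \<inter> vars_B_S M = {}"

end

(* The map commutes with every construction in the rules, by induction on the proof. Only the
   substitution rule is delicate: for x outside Z, extending commutes with SbF and preserves CF,
   whereas for x in Z the step merely repeats an earlier formula, because x does not occur in it.
   The repetition is then justified by the trivial substitution of x for x. *)
theory Submission imports Defs begin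

section \<open>Trivial and vacuous substitutions\<close>

lemma sb_list_self: "sb_list l [Var x] x = l"
  by (induction l) (auto simp: sb_list_def)

lemma sb_list_fresh: "x \<notin> var_list l \<Longrightarrow> sb_list l m x = l"
  by (induction l) (auto simp: sb_list_def var_list_def)

lemma SbF_self: "SbF F [Var x] x = F"
  by (induction F) (simp_all add: sb_list_self)

text \<open>If \<open>x\<close> is free below a quantifier over \<open>y\<close>, then
  \<open>y\<close> differs from \<open>x\<close> and so does not occur in \<open>[Var x]\<close>:
  nothing is captured.\<close>

lemma CF_self: "CF F [Var x] x"
  by (induction F) (auto simp: var_list_def)

lemma SbF_fresh: "x \<notin> vars F \<Longrightarrow> SbF F l x = F"
  by (induction F) (auto simp: sb_list_fresh intro!: map_idI)

lemma subformulas_vars: "Quant Q z F' \<in> subformulas F \<Longrightarrow> z \<in> vars F"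
  by (induction F) auto

section \<open>Formulas with restricted argument lists\<close>

lemma preds_SbF: "preds (SbF F l x) = preds F"
  by (induction F) auto

lemma arg_lists_SbF:
  assumes "restricted_arg_lists M L" and "l \<in> L"
  shows "arg_lists F \<subseteq> L \<Longrightarrow> arg_lists (SbF F l x) \<subseteq> L"
  using assms by (induction F) (auto simp: restricted_arg_lists_def)

lemma SbF_formulas_restr:
  assumes "restricted_arg_lists M L" and "l \<in> L" and "F \<in> formulas_restr M L"
  shows "SbF F l x \<in> formulas_restr M L"
  using assms arg_lists_SbF[OF assms(1,2), of F x]
  by (auto simp: formulas_restr_def formulas_def preds_SbF restricted_arg_lists_def)

lemma formulas_restr_iff:
  assumes "restricted_arg_lists M L"
  shows "F \<in> formulas_restr M L \<longleftrightarrow> arg_lists F \<subseteq> L \<and> preds F \<subseteq> P_M M"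
  using assms by (auto simp: formulas_restr_def formulas_def restricted_arg_lists_def)

lemma arg_lists_imps: "arg_lists (imps Fs G) = (\<Union>F\<in>set Fs. arg_lists F) \<union> arg_lists G"
  by (induction Fs) (auto simp: imps_def)

lemma preds_imps: "preds (imps Fs G) = (\<Union>F\<in>set Fs. preds F) \<union> preds G"
  by (induction Fs) (auto simp: imps_def)

lemma ext_imps: "ext h (imps Fs G) = imps (map (ext h) Fs) (ext h G)"
  by (induction Fs) (auto simp: imps_def)

text \<open>The prefix of an R-formula adds only implications, so this inclusion is enough to locate
  every quantified subformula.\<close>

lemma subformulas_imps:
  "subformulas (imps Fs G) \<subseteq>
     range (case_prod (Bin Imp)) \<union> (\<Union>F\<in>set Fs. subformulas F) \<union> subformulas G"
  by (induction Fs) (auto simp: imps_def image_iff)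

lemma R_formula_no_quant:
  assumes "R_formula F"
  shows "Quant Q x F' \<notin> subformulas F"
proof -
  obtain Fs G where F: "F = imps Fs G" and "\<forall>H\<in>set Fs. is_prime H" and "is_prime G"
    using assms by (auto simp: R_formula_def)
  moreover have "Quant Q x F' \<notin> subformulas H" if "is_prime H" for H
    using that by (cases H) auto
  ultimately show ?thesis
    using subformulas_imps[of Fs G] by auto
qed

lemma arg_lists_pfm_inst:
  "(\<And>i. arg_lists (s i) \<subseteq> L) \<Longrightarrow> arg_lists (pfm_inst s f) \<subseteq> L"
  by (induction f) auto

lemma preds_pfm_inst:
  "(\<And>i. preds (s i) \<subseteq> P) \<Longrightarrow> preds (pfm_inst s f) \<subseteq> P"
  by (induction f) auto

lemma axioms_formulas_restr:
  assumes "mathematical_system M" and L: "restricted_arg_lists M L" and "F \<in> axioms_restr M L"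
  shows "F \<in> formulas_restr M L"
  using assms(3)
proof cases
  case (taut f s)
  then show ?thesis
    using arg_lists_pfm_inst[of s L f] preds_pfm_inst[of s "P_M M" f]
    by (simp add: formulas_restr_iff[OF L])
next
  case (eq_pred p xs ys)
  then show ?thesis
    using L
    by (auto simp: formulas_restr_iff[OF L] arg_lists_imps preds_imps restricted_arg_lists_def
        set_zip)
next
  case basis
  then show ?thesis
    using assms by (auto simp: formulas_restr_def mathematical_system_def restricted_arg_lists_def)
qed (use L in \<open>auto simp: formulas_restr_iff[OF L] restricted_arg_lists_def\<close>)

text \<open>The laws for \<open>h\<close> concern only lists in \<open>L\<close>, so every step of a
  proof has to be known to have its argument lists there. The same fact gives half of the membership
  in \<open>Phi\<close>.\<close>

lemma proof_formulas_restr: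
  assumes M: "mathematical_system M" and L: "restricted_arg_lists M L" and "is_proof M L Fs"
  shows "set Fs \<subseteq> formulas_restr M L"
  using assms(3)
proof induction
  case (axiom \<Lambda> F)
  then show ?case using axioms_formulas_restr[OF M L] by auto
next
  case (modus_ponens \<Lambda> F G)
  then have "Bin Imp F G \<in> formulas_restr M L" by blast
  with modus_ponens.IH show ?case by (simp add: formulas_restr_iff[OF L])
next
  case (substitution \<Lambda> F l x)
  then show ?case using SbF_formulas_restr[OF L] by auto
next
  case (generalization \<Lambda> F x)
  then have "F \<in> formulas_restr M L" by blast
  with generalization.IH show ?case by (simp add: formulas_restr_iff[OF L])
next
  case (induction \<Lambda> p xs G)
  have "p \<in> P_M M" using M induction by (auto simp: mathematical_system_def)
  then show ?case
    using induction L by (auto simp: formulas_restr_iff[OF L] restricted_arg_lists_def)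
qed simp

lemma preds_ext: "preds (ext h F) = preds F"
  by (induction F) auto

lemma arg_lists_ext: "arg_lists (ext h F) = h ` arg_lists F"
  by (induction F) auto

lemma ext_pfm_inst: "ext h (pfm_inst s f) = pfm_inst (\<lambda>i. ext h (s i)) f"
  by (induction f) auto

text \<open>\<open>vars\<close> also counts variables that stand only after a quantifier, so a
  formula free of \<open>Z\<close> quantifies over no variable of \<open>Z\<close>.\<close>

lemma Phi_no_quant:
  assumes "F \<in> formulas_restr M L" and "vars F \<inter> Z = {}"
  shows "F \<in> Phi M L Z"
  using assms by (auto simp: Phi_def dest: subformulas_vars)

section \<open>The extended map and substitution\<close>

locale Z_hom =
  fixes M :: "('a, 'p) math_sys" and L L' :: "'a word set" and Z :: "var set"
    and h :: "'a word \<Rightarrow> 'a word"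
  assumes M: "mathematical_system M"
    and L: "restricted_arg_lists M L"
    and L': "restricted_arg_lists M L'"
    and hom: "Z_homomorphism M L L' Z h"
begin

lemma h_in: "l \<in> L \<Longrightarrow> h l \<in> L'"
  using hom by (auto simp: Z_homomorphism_def)

lemma h_Var: "h [Var y] = [Var y]"
  using hom by (auto simp: Z_homomorphism_def)

lemma h_sb: "l \<in> L \<Longrightarrow> m \<in> L \<Longrightarrow> x \<notin> Z \<Longrightarrow> h (sb_list l m x) = sb_list (h l) (h m) x"
  using hom by (auto simp: Z_homomorphism_def)

lemma h_vars: "m \<in> L \<Longrightarrow> var_list (h m) \<subseteq> var_list m \<union> Z"
  using hom by (auto simp: Z_homomorphism_def)

lemma Var_in_L: "[Var x] \<in> L"
  using L by (auto simp: restricted_arg_lists_def)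

lemma Var_in_L': "[Var x] \<in> L'"
  using L' by (auto simp: restricted_arg_lists_def)

lemma ext_formulas_restr: "F \<in> formulas_restr M L \<Longrightarrow> ext h F \<in> formulas_restr M L'"
  by (auto simp: formulas_restr_iff[OF L] formulas_restr_iff[OF L'] preds_ext arg_lists_ext h_in)

lemma vars_ext: "arg_lists F \<subseteq> L \<Longrightarrow> vars (ext h F) \<subseteq> vars F \<union> Z"
  by (induction F) (use h_vars in \<open>simp; blast\<close>)+

text \<open>Image lists gain variables from \<open>Z\<close> only, so a variable outside
  \<open>Z\<close> that is not free in \<open>F\<close> is not free in the image either. This
  preserves the side conditions on free variables.\<close>

lemma free_ext: "arg_lists F \<subseteq> L \<Longrightarrow> free (ext h F) \<subseteq> free F \<union> Z"
  by (induction F) (use h_vars in \<open>simp; blast\<close>)+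

lemma ext_SbF:
  "arg_lists F \<subseteq> L \<Longrightarrow> l \<in> L \<Longrightarrow> x \<notin> Z \<Longrightarrow> ext h (SbF F l x) = SbF (ext h F) (h l) x"
  by (induction F) (auto simp: h_sb)

text \<open>At a quantifier over \<open>y\<close>, both \<open>x\<close> and \<open>y\<close> lie
  outside \<open>Z\<close>, whereas \<open>ext h F\<close> and \<open>h l\<close> gain variables
  from \<open>Z\<close> only. Hence \<open>x\<close> does not become free, and \<open>y\<close> does
  not enter the substituted list.\<close>

lemma CF_ext:
  assumes "l \<in> L" and "x \<notin> Z"
  shows "arg_lists F \<subseteq> L \<Longrightarrow> vars F \<inter> Z = {} \<Longrightarrow> CF F l x \<Longrightarrow> CF (ext h F) (h l) x"
proof (induction F)
  case (Quant Q y F)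
  then show ?case
    using free_ext[of F] h_vars[OF assms(1)] assms(2) by auto
qed auto

text \<open>Each single substitution keeps the argument lists in \<open>L\<close>, so
  \<open>ext_SbF\<close> applies again to the result; hence the generalization over
  \<open>G\<close>.\<close>

lemma ext_fold_SbF:
  assumes "length ls = length xs" and "set xs \<inter> Z = {}" and "set ls \<subseteq> L" and "arg_lists G \<subseteq> L"
  shows "ext h (fold (\<lambda>(x, l) H. SbF H l x) (zip xs ls) G) =
    fold (\<lambda>(x, l) H. SbF H l x) (zip xs (map h ls)) (ext h G)"
  using assms
proof (induction ls xs arbitrary: G rule: list_induct2)
  case (Cons l ls x xs)
  then show ?case
    using arg_lists_SbF[OF L, of l G x] by (simp add: ext_SbF)
qed simp

text \<open>Mapping \<open>h\<close> over an argument tuple keeps its length, so the same prime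
  formulas are replaced before and after.\<close>

lemma ext_replace_pred:
  assumes "set xs \<inter> Z = {}" and "arg_lists G \<subseteq> L"
  shows "arg_lists F \<subseteq> L \<Longrightarrow>
    ext h (replace_pred p xs G F) = replace_pred p xs (ext h G) (ext h F)"
  using assms by (induction F) (auto simp: ext_fold_SbF)

section \<open>Images of axioms and of the recursive basis\<close>

lemma ext_axiom:
  assumes "F \<in> axioms_restr M L" and Z: "vars F \<inter> Z = {}"
  shows "ext h F \<in> axioms_restr M L'"
  using assms(1)
proof cases
  case (taut f s)
  then show ?thesis
    by (auto simp: ext_pfm_inst intro!: axioms_restr.taut ext_formulas_restr)
next
  case (eq_refl x)
  then show ?thesis by (simp add: h_Var axioms_restr.eq_refl)
next
  case (eq_list l m x y)
  \<comment> \<open>The premise \<open>Eq [Var x] [Var y]\<close> displays \<open>y\<close>, so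
    \<open>h\<close> commutes with the substitution for \<open>y\<close>.\<close>
  then have "y \<notin> Z" using Z by (auto simp: var_list_def)
  with eq_list show ?thesis
    using axioms_restr.eq_list[OF h_in h_in, of l m x y] by (simp add: h_sb h_Var Var_in_L)
next
  case (eq_pred p xs ys)
  have "map (ext h) (map2 (\<lambda>x y. Eq [Var x] [Var y]) xs ys) =
      (map2 (\<lambda>x y. Eq [Var x] [Var y]) xs ys :: ('a, 'p) fm list)"
    by (simp add: h_Var case_prod_beta')
  moreover have "map h (var_lists zs) = var_lists zs" for zs
    by (simp add: h_Var)
  ultimately show ?thesis
    using eq_pred by (simp add: ext_imps axioms_restr.eq_pred del: map_map)
next
  case (all_elim F x)
  then show ?thesis by (simp add: axioms_restr.all_elim ext_formulas_restr)
next
  case (all_imp F G x)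
  \<comment> \<open>As a quantified variable of the axiom, \<open>x\<close> is outside
    \<open>Z\<close>; the image of \<open>F\<close> gains free variables only in
    \<open>Z\<close>.\<close>
  then have "x \<notin> free (ext h F)"
    using Z free_ext[of F] by (auto simp: formulas_restr_iff[OF L])
  with all_imp show ?thesis by (simp add: axioms_restr.all_imp ext_formulas_restr)
next
  case (ex_def F x)
  then show ?thesis by (simp add: axioms_restr.ex_def ext_formulas_restr)
next
  case basis
  have "F \<in> Phi M L Z"
    using axioms_formulas_restr[OF M L assms(1)] Z by (rule Phi_no_quant)
  then have "ext h F = F"
    using hom basis by (auto simp: Z_homomorphism_def)
  with basis show ?thesis by (simp add: axioms_restr.basis)
qed

text \<open>R-formulas contain no quantifiers, so those of the recursive basis lie in
  \<open>Phi\<close> and are fixed by the extension. The induction rule needs this to keep the same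
  basis formulas on both sides.\<close>

lemma ext_B_S:
  assumes "F \<in> set (B_S (S_M M))"
  shows "arg_lists F \<subseteq> L" and "ext h F = F"
proof -
  have "R_formula F" and B: "F \<in> B_M M" and "F \<in> formulas M"
    using M assms by (auto simp: mathematical_system_def recursive_system_def)
  moreover show "arg_lists F \<subseteq> L"
    using B L by (auto simp: restricted_arg_lists_def)
  ultimately have "F \<in> B_M M \<inter> Phi M L Z"
    by (auto simp: Phi_def formulas_restr_def R_formula_no_quant)
  then show "ext h F = F"
    using hom by (auto simp: Z_homomorphism_def)
qed

section \<open>Images of proofs\<close>

lemma ext_proof:
  "is_proof M L Fs \<Longrightarrow> \<forall>F\<in>set Fs. vars F \<inter> Z = {} \<Longrightarrow> is_proof M L' (map (ext h) Fs)"
proof (induction rule: is_proof.induct)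
  case empty
  then show ?case by (simp add: is_proof.empty)
next
  case (axiom \<Lambda> F)
  then show ?case by (simp add: is_proof.axiom ext_axiom)
next
  case (modus_ponens \<Lambda> F G)
  then have "ext h F \<in> set (map (ext h) \<Lambda>)" and "ext h (Bin Imp F G) \<in> set (map (ext h) \<Lambda>)"
    by (simp_all only: set_map imageI)
  with modus_ponens show ?case
    using is_proof.modus_ponens[of M L' "map (ext h) \<Lambda>" "ext h F" "ext h G"] by simp
next
  case (substitution \<Lambda> F l x)
  then have pr: "is_proof M L' (map (ext h) \<Lambda>)" and F: "ext h F \<in> set (map (ext h) \<Lambda>)"
    and Z: "vars F \<inter> Z = {}"
    by auto
  have args: "arg_lists F \<subseteq> L"
    using proof_formulas_restr[OF M L] substitution by (auto simp: formulas_restr_def)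
  show ?case
  proof (cases "x \<in> Z")
    case True
    then have "SbF F l x = F" using Z by (intro SbF_fresh) auto
    then show ?thesis
      using is_proof.substitution[OF pr F Var_in_L' CF_self, of x] by (simp add: SbF_self)
  next
    case False
    with substitution args Z show ?thesis
      using is_proof.substitution[OF pr F h_in CF_ext, of l x] by (simp add: ext_SbF)
  qed
next
  case (generalization \<Lambda> F x)
  then show ?case by (simp add: is_proof.generalization)
next
  case (induction \<Lambda> p xs G)
  \<comment> \<open>The variables \<open>xs\<close> are the arguments of \<open>p\<close> in the
    derived implication, which avoids \<open>Z\<close>.\<close>
  have xs: "set xs \<inter> Z = {}"
    using induction.prems by (auto simp: var_list_def)
  have G: "arg_lists G \<subseteq> L"
    using induction by (auto simp: formulas_restr_def)
  have "Z \<inter> vars_B_S M = {}"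
    using hom by (auto simp: Z_homomorphism_def)
  \<comment> \<open>The image of \<open>G\<close> may contain new variables, but they belong to
    \<open>Z\<close>, and \<open>Z\<close> does not meet the variables of the recursive
    basis.\<close>
  then have fresh: "(set xs \<union> vars (ext h G)) \<inter> vars_B_S M = {}"
    using vars_ext[OF G] induction.hyps by blast
  have step: "replace_pred p xs (ext h G) F \<in> set (map (ext h) \<Lambda>)"
    if F: "F \<in> set (B_S (S_M M))" and "R_conclusion F = Pred p ls" "length ls = length xs" for F ls
  proof -
    \<comment> \<open>Since \<open>F\<close> is its own image, the premise required for
      \<open>ext h G\<close> is the image of the premise for \<open>G\<close>, which is already a
      step.\<close>
    have "replace_pred p xs (ext h G) F = ext h (replace_pred p xs G F)"
      using ext_replace_pred[OF xs G ext_B_S(1)[OF F], of p] ext_B_S(2)[OF F] by simp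
    then show ?thesis
      using induction.hyps that by (metis imageI set_map)
  qed
  have "is_proof M L' (map (ext h) \<Lambda> @ [Bin Imp (Pred p (var_lists xs)) (ext h G)])"
    using induction.IH induction.prems induction.hyps fresh step
    by (intro is_proof.induction ext_formulas_restr) auto
  then show ?case by (simp add: h_Var comp_def)
qed

end

theorem mainTheorem15:
  fixes M :: "('a, 'p) math_sys"
    and L L' :: "'a word set"
    and Z :: "var set"
    and h :: "'a word \<Rightarrow> 'a word"
    and Fs :: "('a, 'p) fm list"
  assumes "mathematical_system M"
    and "restricted_arg_lists M L"
    and "restricted_arg_lists M L'"
    and "Z_homomorphism M L L' Z h"
    and "is_proof M L Fs"
    and "\<forall>F\<in>set Fs. vars F \<inter> Z = {}"
  shows "set Fs \<subseteq> Phi M L Z \<and> is_proof M L' (map (ext h) Fs)"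
proof -
  interpret Z_hom M L L' Z h
    using assms by unfold_locales
  show ?thesis
    using proof_formulas_restr[OF assms(1,2,5)] assms(6) ext_proof[OF assms(5,6)]
    by (blast intro: Phi_no_quant)
qed

end
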